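(* Let $0<\kappa_\varepsilon<1$ and $x^*\in\mathbb{R}^2$. For a unicycle position $x\in\mathbb{R}^2$ and orientation $\theta\in[-\pi,\pi)$, let $\varepsilon=\kappa_\varepsilon\|x-x^*\|$ and let $x_\varepsilon=x+\varepsilon(\cos\theta,\sin\theta)^{\mathrm T}$ be the associated headway point. Then, for all $\theta\in[-\pi,\pi)$, $$x=x^*\iff x_\varepsilon=x^*.$$
   Context: $\|\cdot\|$ is the Euclidean norm on $\mathbb{R}^2$. The number $\varepsilon$ is called the adaptive headway distance. *)

theory Defs
  imports "HOL-Analysis.Analysis"
begin

definition adaptive_headway_distance :: "real \<Rightarrow> real^2 \<Rightarrow> real^2 \<Rightarrow> real" where
  "adaptive_headway_distance \<kappa> xstar x = \<kappa> * norm (x - xstar)"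

definition headway_point :: "real \<Rightarrow> real^2 \<Rightarrow> real \<Rightarrow> real^2" where
  "headway_point \<epsilon> x \<theta> = x + \<epsilon> *\<^sub>R vector [cos \<theta>, sin \<theta>]"

end

theory Submission
  imports Defs
begin

text \<open>The displacement from \<open>x\<close> to the headway point is a unit vector
  (\<open>norm_cos_sin_vector\<close>) scaled by \<kappa> times the distance d from \<open>x\<close>
  to \<open>xstar\<close>, so its length is \<kappa> d whatever the heading. If \<open>x\<close> is
  the goal, it vanishes; if the headway point is the goal, its length is also d, and d = \<kappa> d
  with \<kappa> < 1 forces d = 0.\<close>

lemma norm_cos_sin_vector: "norm (vector [cos \<theta>, sin \<theta>] :: real^2) = 1"
  by (simp add: norm_vec_def L2_set_def sum_2)

theorem lemma1:
  fixes \<kappa> :: real and xstar x :: "real^2"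
  assumes "0 < \<kappa>" and "\<kappa> < 1"
  shows "\<forall>\<theta>\<in>{-pi..<pi}.
    x = xstar \<longleftrightarrow>
    headway_point (adaptive_headway_distance \<kappa> xstar x) x \<theta> = xstar"
proof (intro ballI iffI)
  fix \<theta> :: real
  assume "x = xstar"
  then show "headway_point (adaptive_headway_distance \<kappa> xstar x) x \<theta> = xstar"
    by (simp add: headway_point_def adaptive_headway_distance_def)
next
  fix \<theta> :: real
  assume "headway_point (adaptive_headway_distance \<kappa> xstar x) x \<theta> = xstar"
  then have "xstar - x = (\<kappa> * norm (x - xstar)) *\<^sub>R vector [cos \<theta>, sin \<theta>]"
    by (metis add_diff_cancel_left' headway_point_def adaptive_headway_distance_def)
  then have "norm (xstar - x) = norm ((\<kappa> * norm (x - xstar)) *\<^sub>R (vector [cos \<theta>, sin \<theta>] :: real^2))"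
    by (rule arg_cong)
  \<comment> \<open>Positivity of \<kappa> removes the absolute value that the norm puts on the
    scalar.\<close>
  then have "norm (x - xstar) = \<kappa> * norm (x - xstar)"
    using assms(1) by (simp add: norm_cos_sin_vector norm_minus_commute abs_mult)
  \<comment> \<open>Cancelling a nonzero norm would give \<kappa> = 1.\<close>
  then show "x = xstar"
    using assms(2) by simp
qed

end
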